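(* Let $L:\mathcal{H}(\mathbb{D})\to\mathcal{H}(\mathbb{D})$ be a continuous complex linear operator. Suppose $f\in\mathcal{H}(\mathbb{D})$ is such that $$L\left[\frac{1+xz}{1+yz}f\right](z)\ne0\quad\text{for all } z\in\mathbb{D},\ x,y\in\mathbb{T},$$ and $$\left|\frac{L\left[\frac{zf}{1+yz}\right]}{L\left[\frac{f}{1+yz}\right]}\right|(0)<1\quad\text{for at least one } y\in\mathbb{T}.$$ Then for every $h\in\mathcal{H}(\mathbb{D})$ we have $$\frac{L[h]}{L[f]}(\mathbb{D})\subset\overline{\operatorname{co}}\left(\frac{h}{f}(\mathbb{D})\right).$$
   Context: $\mathbb{D}=\{z\in\mathbb{C}:|z|<1\}$, $\mathbb{T}=\{z\in\mathbb{C}:|z|=1\}$, $\mathcal{H}(\mathbb{D})$ is the space of functions analytic in $\mathbb{D}$ with the topology of uniform convergence on compact subsets, and $\overline{\operatorname{co}}$ denotes the closed convex hull in $\mathbb{C}$. The quotient $h/f$ is regarded as a meromorphic function on $\mathbb{D}$ (removable singularities removed), and $(h/f)(\mathbb{D})$ is its set of finite values. *)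

theory Defs
  imports "HOL-Complex_Analysis.Complex_Analysis"
begin

abbreviation unit_disc :: "complex set" where
  "unit_disc \<equiv> ball 0 1"

abbreviation unit_circle :: "complex set" where
  "unit_circle \<equiv> sphere 0 1"

text \<open>
  The space of analytic functions on the unit disc with the topology of uniform convergence on
  compact subsets. An analytic function on the disc is represented by any total function that is
  holomorphic on the disc; the values off the disc are irrelevant. Two representatives of the same
  function are topologically indistinguishable, so a continuous map of this space into itself
  descends to a continuous map of the actual function space (lemma
  \<open>continuous_operator_cong\<close> below).
\<close>

definition hol_disc_open :: "(complex \<Rightarrow> complex) set \<Rightarrow> bool" where
  "hol_disc_open U \<longleftrightarrow>
     (\<forall>f\<in>U. f holomorphic_on unit_disc \<and>
        (\<exists>K e. compact K \<and> K \<subseteq> unit_disc \<and> e > 0 \<and>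
           (\<forall>g. g holomorphic_on unit_disc \<and> (\<forall>z\<in>K. dist (g z) (f z) < e) \<longrightarrow> g \<in> U)))"

lemma istopology_hol_disc_open: "istopology hol_disc_open"
  unfolding istopology_def
proof (intro conjI allI impI)
  fix S T assume S: "hol_disc_open S" and T: "hol_disc_open T"
  show "hol_disc_open (S \<inter> T)"
    unfolding hol_disc_open_def
  proof (intro ballI conjI)
    fix f assume f: "f \<in> S \<inter> T"
    then show "f holomorphic_on unit_disc"
      using S unfolding hol_disc_open_def by blast
    obtain K d where K: "compact K" "K \<subseteq> unit_disc" "d > 0"
      "\<And>g. g holomorphic_on unit_disc \<Longrightarrow> (\<forall>z\<in>K. dist (g z) (f z) < d) \<Longrightarrow> g \<in> S"
      using S f unfolding hol_disc_open_def by (metis IntD1)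
    obtain K' d' where K': "compact K'" "K' \<subseteq> unit_disc" "d' > 0"
      "\<And>g. g holomorphic_on unit_disc \<Longrightarrow> (\<forall>z\<in>K'. dist (g z) (f z) < d') \<Longrightarrow> g \<in> T"
      using T f unfolding hol_disc_open_def by (metis IntD2)
    show "\<exists>K e. compact K \<and> K \<subseteq> unit_disc \<and> e > 0 \<and>
        (\<forall>g. g holomorphic_on unit_disc \<and> (\<forall>z\<in>K. dist (g z) (f z) < e) \<longrightarrow> g \<in> S \<inter> T)"
      using K K' by (intro exI[of _ "K \<union> K'"] exI[of _ "min d d'"]) (auto simp: compact_Un)
  qed
next
  fix \<U> :: "(complex \<Rightarrow> complex) set set"
  assume \<U>: "\<forall>U\<in>\<U>. hol_disc_open U"
  show "hol_disc_open (\<Union>\<U>)"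
    unfolding hol_disc_open_def
  proof (intro ballI conjI)
    fix f assume "f \<in> \<Union>\<U>"
    then obtain U where U: "U \<in> \<U>" "f \<in> U" by blast
    then show "f holomorphic_on unit_disc"
      using \<U> unfolding hol_disc_open_def by blast
    obtain K e where "compact K" "K \<subseteq> unit_disc" "e > 0"
      "\<And>g. g holomorphic_on unit_disc \<Longrightarrow> (\<forall>z\<in>K. dist (g z) (f z) < e) \<Longrightarrow> g \<in> U"
      using \<U> U unfolding hol_disc_open_def by metis
    then show "\<exists>K e. compact K \<and> K \<subseteq> unit_disc \<and> e > 0 \<and>
        (\<forall>g. g holomorphic_on unit_disc \<and> (\<forall>z\<in>K. dist (g z) (f z) < e) \<longrightarrow> g \<in> \<Union>\<U>)"
      using U by blast
  qed
qed

definition hol_disc :: "(complex \<Rightarrow> complex) topology" where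
  "hol_disc = topology hol_disc_open"

lemma openin_hol_disc: "openin hol_disc U \<longleftrightarrow> hol_disc_open U"
  by (simp add: hol_disc_def topology_inverse' istopology_hol_disc_open)

lemma topspace_hol_disc: "topspace hol_disc = {f. f holomorphic_on unit_disc}"
proof
  show "topspace hol_disc \<subseteq> {f. f holomorphic_on unit_disc}"
    using openin_topspace[of hol_disc] unfolding openin_hol_disc hol_disc_open_def by blast
  have "hol_disc_open {f. f holomorphic_on unit_disc}"
    unfolding hol_disc_open_def
    by (intro ballI conjI exI[of _ "{}"] exI[of _ "1::real"]) auto
  then show "{f. f holomorphic_on unit_disc} \<subseteq> topspace hol_disc"
    by (simp add: openin_hol_disc openin_subset)
qed

definition continuous_linear_operator ::
    "((complex \<Rightarrow> complex) \<Rightarrow> (complex \<Rightarrow> complex)) \<Rightarrow> bool" where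
  "continuous_linear_operator L \<longleftrightarrow>
     continuous_map hol_disc hol_disc L \<and>
     (\<forall>f g a b. f holomorphic_on unit_disc \<and> g holomorphic_on unit_disc \<longrightarrow>
        (\<forall>z\<in>unit_disc. L (\<lambda>w. a * f w + b * g w) z = a * L f z + b * L g z))"

lemma continuous_operator_cong:
  assumes L: "continuous_map hol_disc hol_disc L"
    and f: "f holomorphic_on unit_disc" and g: "g holomorphic_on unit_disc"
    and eq: "\<And>z. z \<in> unit_disc \<Longrightarrow> f z = g z" and z: "z \<in> unit_disc"
  shows "L f z = L g z"
proof (rule ccontr)
  assume ne: "L f z \<noteq> L g z"
  define U where "U = {h. h holomorphic_on unit_disc \<and> h z \<noteq> L g z}"
  have "hol_disc_open U"
    unfolding hol_disc_open_def
  proof (intro ballI conjI)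
    fix h assume h: "h \<in> U"
    then show "h holomorphic_on unit_disc" by (simp add: U_def)
    show "\<exists>K e. compact K \<and> K \<subseteq> unit_disc \<and> e > 0 \<and>
        (\<forall>g. g holomorphic_on unit_disc \<and> (\<forall>z\<in>K. dist (g z) (h z) < e) \<longrightarrow> g \<in> U)"
      using h z by (intro exI[of _ "{z}"] exI[of _ "dist (h z) (L g z)"])
        (auto simp: U_def dist_commute)
  qed
  then have "openin hol_disc {k \<in> topspace hol_disc. L k \<in> U}"
    using L by (auto simp: continuous_map_def openin_hol_disc)
  moreover have "f \<in> {k \<in> topspace hol_disc. L k \<in> U}"
    using f L ne by (auto simp: topspace_hol_disc U_def continuous_map_def Pi_iff)
  ultimately have "\<exists>K e. compact K \<and> K \<subseteq> unit_disc \<and> e > 0 \<and>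
      (\<forall>k. k holomorphic_on unit_disc \<and> (\<forall>z\<in>K. dist (k z) (f z) < e) \<longrightarrow>
        k \<in> {k \<in> topspace hol_disc. L k \<in> U})"
    unfolding openin_hol_disc hol_disc_open_def by (elim ballE conjE) auto
  then obtain K e where K: "K \<subseteq> unit_disc" "e > 0"
    "\<forall>k. k holomorphic_on unit_disc \<and> (\<forall>z\<in>K. dist (k z) (f z) < e) \<longrightarrow>
      k \<in> {k \<in> topspace hol_disc. L k \<in> U}"
    by (elim exE conjE)
  have "\<forall>z\<in>K. dist (g z) (f z) < e"
    using K eq by auto
  with K(3) g have "g \<in> {k \<in> topspace hol_disc. L k \<in> U}" by simp
  then have "L g \<in> U" by simp
  then show False by (simp add: U_def)
qed

text \<open>
  The finite values on \<open>D\<close> of a meromorphic function given by a pointwise formula \<open>q\<close>, for instance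
  a quotient of analytic functions: removable singularities are filled in, so that the junk values
  of \<open>q\<close> at zeros of the denominator do not count. Poles have to be excluded explicitly since
  \<^const>\<open>remove_sings\<close> is \<open>0\<close> there.
\<close>

definition finite_values :: "(complex \<Rightarrow> complex) \<Rightarrow> complex set \<Rightarrow> complex set" where
  "finite_values q D = remove_sings q ` {z \<in> D. \<not> is_pole q z}"

end

theory Submission
  imports Defs
begin

text \<open>
  Fix \<open>z\<close> in the disc and consider the functional \<open>\<Lambda> g = L (\<lambda>w. f w * g w) z / L f z\<close>, which is continuous,
  linear and takes the value \<open>1\<close> at \<open>1\<close>. The nonvanishing hypothesis says that
  \<open>\<Lambda> (1 / (1 + y * w)) + x * \<Lambda> (w / (1 + y * w))\<close> is never \<open>0\<close> for \<open>x\<close>, \<open>y\<close> on the circle, so the two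
  terms never have the same modulus. Since they add up to \<open>1\<close> for \<open>x = y\<close>, this means that
  \<open>\<Lambda> (1 / (1 + y * w))\<close> avoids the line \<open>Re u = 1 / 2\<close>. The second hypothesis decides the side for one
  \<open>y\<close> and \<open>z = 0\<close>, and connectedness of the circle and of the disc transports it to all \<open>y\<close> and \<open>z\<close>:
  \<open>Re (\<Lambda> (1 / (1 + y * w))) > 1 / 2\<close> (\<open>positive_disc_functional_operator\<close>).

  This is the hypothesis of Herglotz's representation theorem: on functions analytic across the
  circle, \<open>\<Lambda>\<close> is integration against a probability measure on the circle, so it takes means of
  values. An elementary form of this suffices. With \<open>\<omega> = exp (2 * pi * \<i> / N)\<close>, the numbers
  \<open>(2 * Re (\<Lambda> (1 / (1 - cnj (\<omega> ^ k) * w))) - 1) / N\<close> are nonnegative, and for every polynomial \<open>p\<close> the sums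
  of \<open>p (\<omega> ^ k)\<close> with these weights converge to \<open>\<Lambda> p\<close> as \<open>N\<close> grows (\<open>mass_polynomial_tendsto\<close>). So
  a lower bound for \<open>Re p\<close> on the circle is one for \<open>Re (\<Lambda> p)\<close>. Taylor polynomials of dilations
  extend this to analytic functions, and separation by hyperplanes turns it into
  \<open>\<Lambda> P \<in> closure (convex hull (P ` unit_disc))\<close> (\<open>in_closed_convex_hull\<close>).

  If \<open>h / f\<close> has no pole in the disc, then \<open>h = f * P\<close> with \<open>P\<close> analytic, whose values are the finite
  values of \<open>h / f\<close>, and \<open>L h z / L f z = \<Lambda> P\<close>. If there is a pole, the closed convex hull is the whole
  plane (\<open>pole_imp_finite_values_dense_hull\<close>).
\<close>

section \<open>The topology of locally uniform convergence\<close>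

lemma compact_subset_unit_disc:
  assumes "compact K" and "K \<subseteq> unit_disc"
  obtains s where "0 \<le> s" "s < 1" "K \<subseteq> cball 0 s"
proof (cases "K = {}")
  case True
  then show ?thesis by (intro that[of 0]) auto
next
  case False
  have "continuous_on K norm" by (intro continuous_intros)
  then obtain x where "x \<in> K" "\<forall>y\<in>K. norm y \<le> norm x"
    using continuous_attains_sup[OF assms(1) False] by blast
  then show ?thesis using assms(2) by (intro that[of "norm x"]) auto
qed

lemma openin_hol_discE:
  assumes U: "openin hol_disc U" and f: "f \<in> U"
  obtains K e where "compact K" "K \<subseteq> unit_disc" "e > 0"
    "\<And>h. h holomorphic_on unit_disc \<Longrightarrow> (\<forall>z\<in>K. dist (h z) (f z) < e) \<Longrightarrow> h \<in> U"
proof -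
  have "\<exists>K e. compact K \<and> K \<subseteq> unit_disc \<and> e > 0 \<and>
      (\<forall>g. g holomorphic_on unit_disc \<and> (\<forall>z\<in>K. dist (g z) (f z) < e) \<longrightarrow> g \<in> U)"
    using bspec[OF U[unfolded openin_hol_disc hol_disc_open_def] f] by (rule conjunct2)
  then show ?thesis using that by (elim exE conjE) simp
qed

text \<open>
  The discs \<open>cball 0 s\<close> exhaust the compact subsets, so uniform estimates on them, where geometric
  series give explicit bounds, are enough for convergence in \<^const>\<open>hol_disc\<close>.
\<close>

lemma limitin_hol_discI:
  assumes hol: "\<forall>\<^sub>F i in F. g i holomorphic_on unit_disc" and l: "l holomorphic_on unit_disc"
    and lim: "\<And>s. 0 \<le> s \<Longrightarrow> s < 1 \<Longrightarrow> uniform_limit (cball 0 s) g l F"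
  shows "limitin hol_disc g l F"
  unfolding limitin_def
proof (intro conjI allI impI)
  show "l \<in> topspace hol_disc" using l by (simp add: topspace_hol_disc)
  fix U assume "openin hol_disc U \<and> l \<in> U"
  then have "openin hol_disc U" "l \<in> U" by simp_all
  then obtain K e where K: "compact K" "K \<subseteq> unit_disc" "e > 0"
    and U: "\<And>h. h holomorphic_on unit_disc \<Longrightarrow> (\<forall>z\<in>K. dist (h z) (l z) < e) \<Longrightarrow> h \<in> U"
    using openin_hol_discE by metis
  obtain s where s: "0 \<le> s" "s < 1" "K \<subseteq> cball 0 s"
    using compact_subset_unit_disc K(1,2) by blast
  have "\<forall>\<^sub>F i in F. \<forall>z\<in>cball 0 s. dist (g i z) (l z) < e"
    using uniform_limitD[OF lim[OF s(1,2)] K(3)] .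
  with hol show "\<forall>\<^sub>F i in F. g i \<in> U"
    by eventually_elim (use U s(3) in blast)
qed

lemma continuous_map_hol_disc_eval:
  assumes "z \<in> unit_disc"
  shows "continuous_map hol_disc euclidean (\<lambda>f. f z)"
  unfolding continuous_map_def
proof (intro conjI allI impI)
  fix V :: "complex set" assume "openin euclidean V"
  then have V: "open V" by simp
  show "openin hol_disc {f \<in> topspace hol_disc. f z \<in> V}"
    unfolding openin_hol_disc hol_disc_open_def
  proof (intro ballI conjI)
    fix f assume f: "f \<in> {f \<in> topspace hol_disc. f z \<in> V}"
    then show "f holomorphic_on unit_disc" by (simp add: topspace_hol_disc)
    obtain e where "e > 0" "\<And>v. dist v (f z) < e \<Longrightarrow> v \<in> V"
      using V f unfolding open_dist by blast
    then show "\<exists>K e. compact K \<and> K \<subseteq> unit_disc \<and> e > 0 \<and>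
        (\<forall>g. g holomorphic_on unit_disc \<and> (\<forall>z\<in>K. dist (g z) (f z) < e) \<longrightarrow>
          g \<in> {f \<in> topspace hol_disc. f z \<in> V})"
      using assms by (intro exI[of _ "{z}"] exI[of _ e]) (auto simp: topspace_hol_disc)
  qed
qed auto

lemma continuous_map_hol_disc_mult:
  assumes f: "f holomorphic_on unit_disc"
  shows "continuous_map hol_disc hol_disc (\<lambda>g w. f w * g w)"
  unfolding continuous_map_def
proof (intro conjI allI impI)
  show "(\<lambda>g w. f w * g w) \<in> topspace hol_disc \<rightarrow> topspace hol_disc"
    using f by (auto simp: topspace_hol_disc intro!: holomorphic_intros)
  fix U assume U: "openin hol_disc U"
  show "openin hol_disc {g \<in> topspace hol_disc. (\<lambda>w. f w * g w) \<in> U}"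
    unfolding openin_hol_disc hol_disc_open_def
  proof (intro ballI conjI)
    fix g assume g: "g \<in> {g \<in> topspace hol_disc. (\<lambda>w. f w * g w) \<in> U}"
    then show "g holomorphic_on unit_disc" by (simp add: topspace_hol_disc)
    from g have "(\<lambda>w. f w * g w) \<in> U" by simp
    from openin_hol_discE[OF U this]
    obtain K e where K: "compact K" "K \<subseteq> unit_disc" "e > 0"
      and e: "\<And>h. h holomorphic_on unit_disc \<Longrightarrow> (\<forall>z\<in>K. dist (h z) (f z * g z) < e) \<Longrightarrow> h \<in> U"
      by metis
    have "compact (f ` K)"
      using K f by (intro compact_continuous_image)
        (auto intro: holomorphic_on_imp_continuous_on holomorphic_on_subset)
    then obtain M where M: "M > 0" "\<And>z. z \<in> K \<Longrightarrow> norm (f z) \<le> M"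
      by (metis bounded_pos compact_imp_bounded image_eqI)
    have "(\<lambda>w. f w * h w) \<in> U"
      if h: "h holomorphic_on unit_disc" and d: "\<forall>z\<in>K. dist (h z) (g z) < e / M" for h
    proof (rule e)
      show "(\<lambda>w. f w * h w) holomorphic_on unit_disc" using f h by (intro holomorphic_intros)
      show "\<forall>z\<in>K. dist (f z * h z) (f z * g z) < e"
      proof
        fix z assume z: "z \<in> K"
        have "dist (f z * h z) (f z * g z) = norm (f z) * dist (h z) (g z)"
          by (simp add: dist_norm norm_mult flip: right_diff_distrib)
        also have "\<dots> \<le> M * dist (h z) (g z)"
          using M(2)[OF z] by (intro mult_right_mono) auto
        also have "\<dots> < e" using d z M(1) by (simp add: pos_less_divide_eq mult.commute)
        finally show "dist (f z * h z) (f z * g z) < e" .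
      qed
    qed
    then show "\<exists>K e. compact K \<and> K \<subseteq> unit_disc \<and> e > 0 \<and>
        (\<forall>h. h holomorphic_on unit_disc \<and> (\<forall>z\<in>K. dist (h z) (g z) < e) \<longrightarrow>
          h \<in> {g \<in> topspace hol_disc. (\<lambda>w. f w * g w) \<in> U})"
      using K M(1) by (intro exI[of _ K] exI[of _ "e / M"]) (auto simp: topspace_hol_disc)
  qed
qed

section \<open>Continuous linear functionals on analytic functions\<close>

locale disc_functional =
  fixes \<Lambda> :: "(complex \<Rightarrow> complex) \<Rightarrow> complex"
  assumes continuous: "continuous_map hol_disc euclidean \<Lambda>"
    and linear: "f holomorphic_on unit_disc \<Longrightarrow> g holomorphic_on unit_disc \<Longrightarrow>
      \<Lambda> (\<lambda>w. a * f w + b * g w) = a * \<Lambda> f + b * \<Lambda> g"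
begin

lemma tendsto:
  assumes "\<forall>\<^sub>F i in F. g i holomorphic_on unit_disc" "l holomorphic_on unit_disc"
    and "\<And>s. 0 \<le> s \<Longrightarrow> s < 1 \<Longrightarrow> uniform_limit (cball 0 s) g l F"
  shows "((\<lambda>i. \<Lambda> (g i)) \<longlongrightarrow> \<Lambda> l) F"
  using continuous_map_limit[OF continuous limitin_hol_discI[OF assms]] by (simp add: o_def)

lemma cong:
  assumes f: "f holomorphic_on unit_disc" and eq: "\<And>w. w \<in> unit_disc \<Longrightarrow> f w = g w"
  shows "\<Lambda> f = \<Lambda> g"
proof -
  have g: "g holomorphic_on unit_disc"
    using holomorphic_transform[OF f eq] .
  have "(\<lambda>_::nat. \<Lambda> f) \<longlonglongrightarrow> \<Lambda> g"
    using f g eq by (intro tendsto) (auto intro!: uniform_limitI always_eventually)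
  then show ?thesis by (simp add: LIMSEQ_const_iff)
qed

lemma scale: "f holomorphic_on unit_disc \<Longrightarrow> \<Lambda> (\<lambda>w. a * f w) = a * \<Lambda> f"
  using linear[of f f a 0] by simp

lemma sum:
  assumes "finite I" "\<And>i. i \<in> I \<Longrightarrow> g i holomorphic_on unit_disc"
  shows "\<Lambda> (\<lambda>w. \<Sum>i\<in>I. a i * g i w) = (\<Sum>i\<in>I. a i * \<Lambda> (g i))"
  using assms
proof (induction rule: finite_induct)
  case empty
  then show ?case using linear[of "\<lambda>_. 0" "\<lambda>_. 0" 0 0] by simp
next
  case (insert j I)
  have "\<Lambda> (\<lambda>w. a j * g j w + 1 * (\<Sum>i\<in>I. a i * g i w))
      = a j * \<Lambda> (g j) + 1 * \<Lambda> (\<lambda>w. \<Sum>i\<in>I. a i * g i w)"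
    using insert.prems by (intro linear holomorphic_intros) auto
  then show ?case using insert by simp
qed

end

section \<open>Averages over roots of unity\<close>

lemma sum_powers_roots_of_unity:
  fixes N n j :: nat
  assumes "n < N" "j < N"
  defines "\<omega> \<equiv> cis (2 * pi / N)"
  shows "(\<Sum>k<N. \<omega> ^ (k * n) * cnj (\<omega> ^ k) ^ j) = (if n = j then of_nat N else 0)"
proof -
  define \<zeta> where "\<zeta> = \<omega> ^ n * cnj \<omega> ^ j"
  have N: "N > 0" using assms by simp
  have root: "\<omega> ^ N = 1" using N by (simp add: \<omega>_def Complex.DeMoivre)
  have unit: "\<omega> * cnj \<omega> = 1" by (simp add: \<omega>_def cis_cnj cis_mult)
  have "(\<Sum>k<N. \<omega> ^ (k * n) * cnj (\<omega> ^ k) ^ j) = (\<Sum>k<N. \<zeta> ^ k)"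
    by (intro sum.cong) (simp_all add: \<zeta>_def power_mult_distrib mult.commute flip: power_mult)
  also have "\<dots> = (if n = j then of_nat N else 0)"
  proof (cases "n = j")
    case True
    then have "\<zeta> = 1" using unit by (simp add: \<zeta>_def flip: power_mult_distrib)
    with True show ?thesis by simp
  next
    case False
    have cis_pow: "\<omega> ^ m = exp (2 * of_real pi * \<i> * of_nat m / of_nat N)" for m
      unfolding \<omega>_def cis_conv_exp exp_of_nat_mult[symmetric]
      by (rule arg_cong[of _ _ exp]) simp
    have "\<omega> ^ n \<noteq> \<omega> ^ j"
      using complex_root_unity_eq[of N n j] assms(1,2) N False unfolding cis_pow by simp
    moreover have "\<zeta> * \<omega> ^ j = \<omega> ^ n * (\<omega> * cnj \<omega>) ^ j"
      by (simp add: \<zeta>_def power_mult_distrib mult_ac)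
    then have "\<zeta> * \<omega> ^ j = \<omega> ^ n" by (simp add: unit)
    ultimately have "\<zeta> \<noteq> 1" by auto
    have "\<zeta> ^ N = (\<omega> ^ N) ^ n * cnj (\<omega> ^ N) ^ j"
      by (simp add: \<zeta>_def power_mult_distrib mult.commute flip: power_mult)
    then have "\<zeta> ^ N = 1" by (simp add: root)
    with \<open>\<zeta> \<noteq> 1\<close> False show ?thesis by (simp add: geometric_sum)
  qed
  finally show ?thesis .
qed

text \<open>
  Expanding \<open>1 / (1 - cnj (\<omega> ^ k) * w)\<close> as a geometric series, cut off after \<open>N\<close> terms at the cost of
  the factor \<open>1 / (1 - w ^ N)\<close>, orthogonality of the characters of the \<open>N\<close>-th roots of unity leaves
  only the term of degree \<open>n\<close>. This is a discrete form of
  \<open>w ^ n = 1 / (2 * pi) * (\<integral>t=0..2 * pi. exp (\<i> * n * t) / (1 - exp (- \<i> * t) * w))\<close>.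
\<close>

lemma kernel_average:
  fixes N n :: nat and w :: complex
  assumes n: "n < N" and w: "norm w < 1"
  defines "\<omega> \<equiv> cis (2 * pi / N)"
  shows "(\<Sum>k<N. \<omega> ^ (k * n) * (1 / (1 - cnj (\<omega> ^ k) * w))) = of_nat N * (w ^ n / (1 - w ^ N))"
proof -
  have N: "N > 0" using n by simp
  have root: "\<omega> ^ N = 1" using N by (simp add: \<omega>_def Complex.DeMoivre)
  have geo: "1 / (1 - cnj (\<omega> ^ k) * w) = (\<Sum>j<N. cnj (\<omega> ^ k) ^ j * w ^ j) / (1 - w ^ N)" for k
  proof -
    have "norm (cnj (\<omega> ^ k) * w) < 1" using w by (simp add: norm_mult norm_power \<omega>_def)
    then have ne: "1 - cnj (\<omega> ^ k) * w \<noteq> 0" by auto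
    have "cnj (\<omega> ^ k) ^ N = cnj ((\<omega> ^ N) ^ k)" by (simp add: mult.commute flip: power_mult)
    then have "(cnj (\<omega> ^ k) * w) ^ N = w ^ N"
      unfolding power_mult_distrib by (simp add: root)
    then have "1 - w ^ N = (1 - cnj (\<omega> ^ k) * w) * (\<Sum>j<N. (cnj (\<omega> ^ k) * w) ^ j)"
      by (metis one_diff_power_eq)
    moreover have "w ^ N \<noteq> 1"
      using w N by (metis norm_one norm_power power_less_one_iff norm_ge_zero less_irrefl)
    ultimately show ?thesis using ne
      by (simp add: field_simps power_mult_distrib del: complex_cnj_power)
  qed
  have "(\<Sum>k<N. \<omega> ^ (k * n) * (1 / (1 - cnj (\<omega> ^ k) * w)))
      = (\<Sum>k<N. \<Sum>j<N. \<omega> ^ (k * n) * cnj (\<omega> ^ k) ^ j * w ^ j) / (1 - w ^ N)"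
    unfolding geo sum_divide_distrib sum_distrib_left by (simp add: mult_ac)
  also have "(\<Sum>k<N. \<Sum>j<N. \<omega> ^ (k * n) * cnj (\<omega> ^ k) ^ j * w ^ j)
      = (\<Sum>j<N. (\<Sum>k<N. \<omega> ^ (k * n) * cnj (\<omega> ^ k) ^ j) * w ^ j)"
    unfolding sum_distrib_right by (rule sum.swap)
  also have "\<dots> = (\<Sum>j<N. (if n = j then of_nat N else 0) * w ^ j)"
    using sum_powers_roots_of_unity[OF n] unfolding \<omega>_def by simp
  also have "\<dots> = of_nat N * w ^ n"
    using n by (simp add: if_distrib[of "\<lambda>c. c * _"] cong: if_cong)
  finally show ?thesis by simp
qed

section \<open>Functionals with the Herglotz property\<close>

lemma one_add_mult_neq_0:
  fixes y w :: complex
  assumes "norm y \<le> 1" "w \<in> unit_disc"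
  shows "1 + y * w \<noteq> 0"
proof
  assume "1 + y * w = 0"
  then have "norm (y * w) = 1" by (metis add_eq_0_iff norm_minus_cancel norm_one)
  moreover have "norm (y * w) < 1"
    using assms by (simp add: norm_mult order_le_less_trans[OF mult_left_le_one_le])
  ultimately show False by simp
qed

lemma holomorphic_kernel:
  assumes "norm y \<le> 1"
  shows "(\<lambda>w. 1 / (1 - y * w)) holomorphic_on unit_disc"
  using one_add_mult_neq_0[of "- y"] assms by (intro holomorphic_intros) auto

lemma power_neq_one_in_disc:
  fixes w :: complex
  assumes "norm w < 1" "N > 0"
  shows "w ^ N \<noteq> 1"
  using assms by (metis norm_one norm_power power_less_one_iff norm_ge_zero less_irrefl)

lemma holomorphic_power_div:
  assumes "N > 0"
  shows "(\<lambda>w. w ^ m / (1 - w ^ N)) holomorphic_on unit_disc"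
  using power_neq_one_in_disc[OF _ assms] by (intro holomorphic_intros) auto

text \<open>
  This bound makes the aliasing error between \<open>w ^ n / (1 - w ^ N)\<close> and \<open>w ^ n\<close> vanish locally
  uniformly in the disc.
\<close>

lemma norm_power_div_le:
  fixes w :: complex
  assumes w: "norm w \<le> s" and s: "s < 1" and N: "N > 0"
  shows "norm (w ^ m / (1 - w ^ N)) \<le> s ^ m / (1 - s)"
proof -
  have s0: "0 \<le> s" using w norm_ge_zero order_trans by blast
  have "norm (w ^ N) \<le> s ^ N" using w by (simp add: norm_power power_mono)
  also have "\<dots> \<le> s" using power_decreasing[of 1 N s] N s s0 by simp
  finally have "1 - s \<le> norm (1 - w ^ N)"
    using norm_triangle_ineq2[of 1 "w ^ N"] by simp
  then show ?thesis
    unfolding norm_divide using w s s0 by (intro frac_le) (auto simp: norm_power power_mono)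
qed

lemma holomorphic_dilation:
  assumes P: "P holomorphic_on unit_disc" and r: "0 < r" "r < 1"
  shows "(\<lambda>w. P (of_real r * w)) holomorphic_on unit_disc"
proof -
  have "r * norm w < 1" if "norm w < 1" for w :: complex
    using r that mult_left_le_one_le[of "norm w" r] by simp
  then have "(\<lambda>w. complex_of_real r * w) ` unit_disc \<subseteq> unit_disc"
    using r by (auto simp: norm_mult)
  then have "(P \<circ> (\<lambda>w. of_real r * w)) holomorphic_on unit_disc"
    using P by (intro holomorphic_on_compose_gen[of _ _ P unit_disc] holomorphic_intros)
  then show ?thesis by (simp add: o_def)
qed

text \<open>
  By Herglotz's theorem the condition on the kernels says that, on functions analytic across the
  circle, \<open>\<Lambda>\<close> is integration against a probability measure on it. Instead of constructing that
  measure, the proof uses nonnegative weights at the \<open>N\<close>-th roots of unity that approximate it.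
\<close>

locale positive_disc_functional = disc_functional +
  assumes normalized: "\<Lambda> (\<lambda>_. 1) = 1"
    and Re_kernel: "y \<in> unit_circle \<Longrightarrow> Re (\<Lambda> (\<lambda>w. 1 / (1 - y * w))) \<ge> 1 / 2"
begin

text \<open>
  The Poisson kernel at the node \<open>\<omega> ^ k\<close> is \<open>Re ((1 + u) / (1 - u)) = 2 * Re (1 / (1 - u)) - 1\<close> for
  \<open>u = cnj (\<omega> ^ k) * w\<close>. Applying \<open>\<Lambda>\<close> before taking the real part, and dividing by the number of
  nodes, gives the mass that the discretised Herglotz measure puts there.
\<close>

definition mass :: "nat \<Rightarrow> nat \<Rightarrow> real" where
  "mass N k = (2 * Re (\<Lambda> (\<lambda>w. 1 / (1 - cnj (cis (2 * pi / N) ^ k) * w))) - 1) / N"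

lemma mass_nonneg: "mass N k \<ge> 0"
  using Re_kernel[of "cnj (cis (2 * pi / N) ^ k)"] by (simp add: mass_def norm_power)

lemma kernel_values_average:
  assumes n: "n < N"
  defines "\<omega> \<equiv> cis (2 * pi / N)"
  shows "(\<Sum>k<N. \<omega> ^ (k * n) * \<Lambda> (\<lambda>w. 1 / (1 - cnj (\<omega> ^ k) * w)))
    = of_nat N * \<Lambda> (\<lambda>w. w ^ n / (1 - w ^ N))"
proof -
  have hol: "(\<lambda>w. 1 / (1 - cnj (\<omega> ^ k) * w)) holomorphic_on unit_disc" for k
    by (rule holomorphic_kernel) (simp add: \<omega>_def norm_power)
  have "(\<Sum>k<N. \<omega> ^ (k * n) * \<Lambda> (\<lambda>w. 1 / (1 - cnj (\<omega> ^ k) * w)))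
      = \<Lambda> (\<lambda>w. \<Sum>k<N. \<omega> ^ (k * n) * (1 / (1 - cnj (\<omega> ^ k) * w)))"
    using hol by (intro sum[symmetric]) auto
  also have "\<dots> = \<Lambda> (\<lambda>w. of_nat N * (w ^ n / (1 - w ^ N)))"
  proof (rule cong)
    show "(\<lambda>w. \<Sum>k<N. \<omega> ^ (k * n) * (1 / (1 - cnj (\<omega> ^ k) * w))) holomorphic_on unit_disc"
      using hol by (intro holomorphic_on_sum holomorphic_on_mult holomorphic_on_const)
  next
    fix w :: complex assume "w \<in> unit_disc"
    then show "(\<Sum>k<N. \<omega> ^ (k * n) * (1 / (1 - cnj (\<omega> ^ k) * w)))
        = of_nat N * (w ^ n / (1 - w ^ N))"
      unfolding \<omega>_def by (intro kernel_average[OF n]) simp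
  qed
  also have "\<dots> = of_nat N * \<Lambda> (\<lambda>w. w ^ n / (1 - w ^ N))"
    using n by (intro scale holomorphic_power_div) auto
  finally show ?thesis .
qed

text \<open>
  Since \<open>2 * Re v = v + cnj v\<close>, the moment of the masses is the average of the kernel values with
  the character \<open>n\<close> plus the conjugate of the average with the character \<open>- n\<close>, which modulo \<open>N\<close> is
  \<open>n'\<close>.
\<close>

lemma mass_moment:
  assumes n: "n < N"
  defines "\<omega> \<equiv> cis (2 * pi / N)"
  defines "n' \<equiv> (if n = 0 then 0 else N - n)"
  shows "(\<Sum>k<N. of_real (mass N k) * \<omega> ^ (k * n))
    = \<Lambda> (\<lambda>w. w ^ n / (1 - w ^ N)) + cnj (\<Lambda> (\<lambda>w. w ^ n' / (1 - w ^ N)))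
      - (if n = 0 then 1 else 0)"
proof -
  define v where "v k = \<Lambda> (\<lambda>w. 1 / (1 - cnj (\<omega> ^ k) * w))" for k
  have N: "N > 0" and n': "n' < N" using n by (auto simp: n'_def)
  have root: "\<omega> ^ N = 1" using N by (simp add: \<omega>_def Complex.DeMoivre)
  have unit: "\<omega> * cnj \<omega> = 1" by (simp add: \<omega>_def cis_cnj cis_mult)
  \<comment> \<open>conjugation reflects the character \<open>n\<close> to \<open>- n\<close>, that is, to \<open>n'\<close> modulo \<open>N\<close>\<close>
  have refl: "\<omega> ^ (k * n) = cnj (\<omega> ^ (k * n'))" for k
  proof (cases "n = 0")
    case False
    then have "k * n + k * n' = N * k"
      using n by (simp add: n'_def flip: distrib_left)
    then have "\<omega> ^ (k * n) * \<omega> ^ (k * n') = (\<omega> ^ N) ^ k"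
      by (simp only: flip: power_add power_mult)
    then have "\<omega> ^ (k * n) * \<omega> ^ (k * n') = 1" by (simp add: root)
    moreover have "cnj (\<omega> ^ (k * n')) * \<omega> ^ (k * n') = 1"
      using unit by (simp add: mult.commute flip: power_mult_distrib)
    ultimately show ?thesis by (metis mult_cancel_right zero_neq_one mult_zero_right)
  qed (simp add: n'_def)
  have mass: "of_real (mass N k) = (v k + cnj (v k) - 1) / of_nat N" for k
    by (simp add: mass_def v_def \<omega>_def complex_add_cnj)
  have sum1: "(\<Sum>k<N. \<omega> ^ (k * n) * v k) = of_nat N * \<Lambda> (\<lambda>w. w ^ n / (1 - w ^ N))"
    unfolding v_def \<omega>_def by (rule kernel_values_average[OF n])
  have "(\<Sum>k<N. \<omega> ^ (k * n) * cnj (v k)) = cnj (\<Sum>k<N. \<omega> ^ (k * n') * v k)"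
    unfolding cnj_sum refl by simp
  also have "\<dots> = of_nat N * cnj (\<Lambda> (\<lambda>w. w ^ n' / (1 - w ^ N)))"
    unfolding v_def \<omega>_def by (subst kernel_values_average[OF n']) simp
  finally have sum2: "(\<Sum>k<N. \<omega> ^ (k * n) * cnj (v k))
      = of_nat N * cnj (\<Lambda> (\<lambda>w. w ^ n' / (1 - w ^ N)))" .
  have sum3: "(\<Sum>k<N. \<omega> ^ (k * n)) = of_nat N * (if n = 0 then 1 else 0)"
    using sum_powers_roots_of_unity[OF n N] by (simp add: \<omega>_def)
  have "(\<Sum>k<N. of_real (mass N k) * \<omega> ^ (k * n))
      = ((\<Sum>k<N. \<omega> ^ (k * n) * v k) + (\<Sum>k<N. \<omega> ^ (k * n) * cnj (v k)) - (\<Sum>k<N. \<omega> ^ (k * n)))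
        / of_nat N"
    unfolding mass sum.distrib[symmetric] sum_subtractf[symmetric] sum_divide_distrib
    by (intro sum.cong) (simp_all add: algebra_simps)
  also have "\<dots> = \<Lambda> (\<lambda>w. w ^ n / (1 - w ^ N)) + cnj (\<Lambda> (\<lambda>w. w ^ n' / (1 - w ^ N)))
      - (if n = 0 then 1 else 0)"
    unfolding sum1 sum2 sum3 using N
    by (simp add: field_simps)
  finally show ?thesis .
qed

lemma power_div_tendsto_0:
  assumes m: "filterlim m at_top sequentially"
  shows "(\<lambda>N. \<Lambda> (\<lambda>w. w ^ m N / (1 - w ^ N))) \<longlonglongrightarrow> 0"
proof -
  have "(\<lambda>N. \<Lambda> (\<lambda>w. w ^ m N / (1 - w ^ N))) \<longlonglongrightarrow> \<Lambda> (\<lambda>_. 0)"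
  proof (rule tendsto)
    show "\<forall>\<^sub>F N in sequentially. (\<lambda>w. w ^ m N / (1 - w ^ N)) holomorphic_on unit_disc"
      using eventually_gt_at_top[of 0] by eventually_elim (rule holomorphic_power_div)
  next
    fix s :: real assume s: "0 \<le> s" "s < 1"
    have "(\<lambda>n. s ^ n) \<longlonglongrightarrow> 0" using s by (intro LIMSEQ_power_zero) simp
    then have "(\<lambda>N. s ^ m N / (1 - s)) \<longlonglongrightarrow> 0"
      using filterlim_compose[OF _ m] tendsto_divide_zero by blast
    then show "uniform_limit (cball 0 s) (\<lambda>N w :: complex. w ^ m N / (1 - w ^ N)) (\<lambda>_. 0)
        sequentially"
    proof (intro uniform_limitI)
      fix e :: real assume "e > 0"
      with \<open>(\<lambda>N. s ^ m N / (1 - s)) \<longlonglongrightarrow> 0\<close>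
      have "\<forall>\<^sub>F N in sequentially. s ^ m N / (1 - s) < e" by (rule order_tendstoD)
      then show "\<forall>\<^sub>F N in sequentially. \<forall>w\<in>cball 0 s.
          dist (w ^ m N / (1 - w ^ N)) (0 :: complex) < e"
        using eventually_gt_at_top[of 0]
      proof eventually_elim
        case (elim N)
        have "dist (w ^ m N / (1 - w ^ N)) 0 < e" if "norm w \<le> s" for w :: complex
          using norm_power_div_le[OF that s(2) elim(2), of "m N"] elim(1)
          unfolding dist_norm by simp
        then show ?case by simp
      qed
    qed
  qed auto
  also have "\<Lambda> (\<lambda>_. 0) = 0" using scale[of "\<lambda>_. 0" 0] by simp
  finally show ?thesis .
qed

text \<open>
  In the formula for the moments the first term tends to \<open>\<Lambda> (\<lambda>w. w ^ n)\<close>. The conjugate term is the error of aliasing: its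
  exponent \<open>N - n\<close> grows, so it vanishes if \<open>n > 0\<close>; for \<open>n = 0\<close> it tends to \<open>1\<close> and cancels
  against the subtracted \<open>1\<close>.
\<close>

lemma mass_moment_tendsto:
  "(\<lambda>N. \<Sum>k<N. of_real (mass N k) * (cis (2 * pi / N) ^ k) ^ n) \<longlonglongrightarrow> \<Lambda> (\<lambda>w. w ^ n)"
proof -
  have split: "\<Lambda> (\<lambda>w. w ^ n / (1 - w ^ N))
      = \<Lambda> (\<lambda>w. w ^ n) + \<Lambda> (\<lambda>w. w ^ (n + N) / (1 - w ^ N))" if N: "N > 0" for N n :: nat
  proof -
    have "\<Lambda> (\<lambda>w. 1 * w ^ n + 1 * (w ^ (n + N) / (1 - w ^ N))) = \<Lambda> (\<lambda>w. w ^ n / (1 - w ^ N))"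
    proof (rule cong)
      show "(\<lambda>w. 1 * w ^ n + 1 * (w ^ (n + N) / (1 - w ^ N))) holomorphic_on unit_disc"
        using N by (intro holomorphic_on_add holomorphic_on_mult holomorphic_power_div
            holomorphic_intros)
      fix w :: complex assume "w \<in> unit_disc"
      then show "1 * w ^ n + 1 * (w ^ (n + N) / (1 - w ^ N)) = w ^ n / (1 - w ^ N)"
        using power_neq_one_in_disc[of w N] N by (simp add: field_simps power_add)
    qed
    moreover have "\<Lambda> (\<lambda>w. 1 * w ^ n + 1 * (w ^ (n + N) / (1 - w ^ N)))
        = 1 * \<Lambda> (\<lambda>w. w ^ n) + 1 * \<Lambda> (\<lambda>w. w ^ (n + N) / (1 - w ^ N))"
      using N by (intro linear holomorphic_power_div) (intro holomorphic_intros)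
    ultimately show ?thesis by simp
  qed
  have shift: "(\<lambda>N. \<Lambda> (\<lambda>w. w ^ (n + N) / (1 - w ^ N))) \<longlonglongrightarrow> 0" for n
    by (rule power_div_tendsto_0) (use filterlim_add_const_nat_at_top[of n] in \<open>simp add: add.commute\<close>)
  have lim: "(\<lambda>N. \<Lambda> (\<lambda>w. w ^ n / (1 - w ^ N))) \<longlonglongrightarrow> \<Lambda> (\<lambda>w. w ^ n)" for n
  proof (rule Lim_transform_eventually)
    show "(\<lambda>N. \<Lambda> (\<lambda>w. w ^ n) + \<Lambda> (\<lambda>w. w ^ (n + N) / (1 - w ^ N))) \<longlonglongrightarrow> \<Lambda> (\<lambda>w. w ^ n)"
      using tendsto_add[OF tendsto_const shift] by simp
    show "\<forall>\<^sub>F N in sequentially. \<Lambda> (\<lambda>w. w ^ n) + \<Lambda> (\<lambda>w. w ^ (n + N) / (1 - w ^ N))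
        = \<Lambda> (\<lambda>w. w ^ n / (1 - w ^ N))"
      using eventually_gt_at_top[of 0] by eventually_elim (rule split[symmetric])
  qed
  define c where "c = (if n = 0 then 1 else 0 :: complex)"
  define n' where "n' N = (if n = 0 then 0 else N - n)" for N
  have "(\<lambda>N. \<Lambda> (\<lambda>w. w ^ n' N / (1 - w ^ N))) \<longlonglongrightarrow> c"
  proof (cases "n = 0")
    case True
    then show ?thesis using lim[of 0] normalized by (simp add: n'_def c_def)
  next
    case False
    then show ?thesis
      unfolding n'_def c_def
      using power_div_tendsto_0[OF filterlim_minus_const_nat_at_top[of n]] by simp
  qed
  then have "(\<lambda>N. \<Lambda> (\<lambda>w. w ^ n / (1 - w ^ N)) + cnj (\<Lambda> (\<lambda>w. w ^ n' N / (1 - w ^ N))) - c)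
      \<longlonglongrightarrow> \<Lambda> (\<lambda>w. w ^ n) + cnj c - c"
    by (intro tendsto_intros lim)
  then have "(\<lambda>N. \<Sum>k<N. of_real (mass N k) * (cis (2 * pi / N) ^ k) ^ n)
      \<longlonglongrightarrow> \<Lambda> (\<lambda>w. w ^ n) + cnj c - c"
  proof (rule Lim_transform_eventually)
    show "\<forall>\<^sub>F N in sequentially. \<Lambda> (\<lambda>w. w ^ n / (1 - w ^ N))
        + cnj (\<Lambda> (\<lambda>w. w ^ n' N / (1 - w ^ N))) - c
        = (\<Sum>k<N. of_real (mass N k) * (cis (2 * pi / N) ^ k) ^ n)"
      using eventually_gt_at_top[of n]
      by eventually_elim
        (simp only: mass_moment n'_def c_def flip: power_mult)
  qed
  then show ?thesis by (cases "n = 0") (simp_all add: c_def)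
qed

lemma mass_polynomial_tendsto:
  "(\<lambda>N. \<Sum>k<N. of_real (mass N k) * (\<Sum>n<d. a n * (cis (2 * pi / N) ^ k) ^ n))
    \<longlonglongrightarrow> \<Lambda> (\<lambda>w. \<Sum>n<d. a n * w ^ n)"
proof -
  have "(\<lambda>N. \<Sum>n<d. a n * (\<Sum>k<N. of_real (mass N k) * (cis (2 * pi / N) ^ k) ^ n))
      \<longlonglongrightarrow> (\<Sum>n<d. a n * \<Lambda> (\<lambda>w. w ^ n))"
    by (intro tendsto_intros mass_moment_tendsto)
  moreover have "(\<Sum>n<d. a n * \<Lambda> (\<lambda>w. w ^ n)) = \<Lambda> (\<lambda>w. \<Sum>n<d. a n * w ^ n)"
    by (intro sum[symmetric] holomorphic_intros) auto
  moreover have "(\<Sum>n<d. a n * (\<Sum>k<N. of_real (mass N k) * (cis (2 * pi / N) ^ k) ^ n))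
      = (\<Sum>k<N. of_real (mass N k) * (\<Sum>n<d. a n * (cis (2 * pi / N) ^ k) ^ n))" for N
    unfolding sum_distrib_left by (subst sum.swap) (simp add: mult_ac)
  ultimately show ?thesis by simp
qed

text \<open>
  Integrals of a function with values in a closed half-plane against nonnegative weights of total
  mass tending to \<open>1\<close> have their limit in that half-plane.
\<close>

lemma Re_polynomial_ge:
  assumes ge: "\<And>u. u \<in> unit_circle \<Longrightarrow> Re (\<Sum>n<d. a n * u ^ n) \<ge> t"
  shows "Re (\<Lambda> (\<lambda>w. \<Sum>n<d. a n * w ^ n)) \<ge> t"
proof -
  have "(\<lambda>N. \<Sum>k<N. of_real (mass N k)) \<longlonglongrightarrow> (1 :: complex)"
    using mass_moment_tendsto[of 0] normalized by simp
  then have "(\<lambda>N. t * Re (\<Sum>k<N. of_real (mass N k))) \<longlonglongrightarrow> t * Re 1"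
    by (intro tendsto_intros)
  moreover have "(\<lambda>N. Re (\<Sum>k<N. of_real (mass N k) * (\<Sum>n<d. a n * (cis (2 * pi / N) ^ k) ^ n)))
    \<longlonglongrightarrow> Re (\<Lambda> (\<lambda>w. \<Sum>n<d. a n * w ^ n))"
    by (intro tendsto_intros mass_polynomial_tendsto)
  moreover have "t * Re (\<Sum>k<N. of_real (mass N k))
      \<le> Re (\<Sum>k<N. of_real (mass N k) * (\<Sum>n<d. a n * (cis (2 * pi / N) ^ k) ^ n))" for N
  proof -
    have "mass N k * t \<le> mass N k * Re (\<Sum>n<d. a n * (cis (2 * pi / N) ^ k) ^ n)" for k
      by (intro mult_left_mono ge mass_nonneg) (simp add: norm_power)
    then have "(\<Sum>k<N. mass N k * t)
        \<le> (\<Sum>k<N. mass N k * Re (\<Sum>n<d. a n * (cis (2 * pi / N) ^ k) ^ n))"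
      by (rule sum_mono)
    then show ?thesis
      by (simp add: sum_distrib_left mult.commute del: Re_sum) (simp add: sum_distrib_left mult.commute)
  qed
  ultimately have "t * Re 1 \<le> Re (\<Lambda> (\<lambda>w. \<Sum>n<d. a n * w ^ n))"
    by (intro LIMSEQ_le) blast+
  then show ?thesis by simp
qed

text \<open>
  The Taylor series of a dilation converges uniformly up to the unit circle. Its partial sums are
  therefore polynomials that violate the half-plane bound on the circle by arbitrarily little.
\<close>

lemma Re_dilation_ge:
  assumes P: "P holomorphic_on unit_disc" and ge: "\<And>w. w \<in> unit_disc \<Longrightarrow> Re (P w) \<ge> t"
    and r: "0 < r" "r < 1"
  shows "Re (\<Lambda> (\<lambda>w. P (of_real r * w))) \<ge> t"
proof (rule field_le_epsilon)
  fix e :: real assume e: "e > 0"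
  define Q where "Q w = P (of_real r * w)" for w
  define a where "a n = (deriv ^^ n) P 0 / fact n * of_real r ^ n" for n
  define S where "S d w = (\<Sum>n<d. a n * w ^ n)" for d w
  have in_disc: "of_real r * w \<in> unit_disc" if "norm w < 1 / r" for w :: complex
    using that r by (simp add: norm_mult field_simps)
  have sums: "(\<lambda>n. a n * w ^ n) sums Q w" if "norm w < 1 / r" for w
    using holomorphic_power_series[OF P in_disc[OF that]]
    by (simp add: a_def Q_def power_mult_distrib mult_ac)
  \<comment> \<open>a point of convergence outside the closed disc, for uniformity up to the circle\<close>
  obtain \<rho> where \<rho>: "1 < \<rho>" "\<rho> < 1 / r" using r dense[of 1 "1 / r"] by auto
  have "summable (\<lambda>n. a n * of_real \<rho> ^ n)"
    using sums[of "of_real \<rho>"] \<rho> by (simp add: sums_iff)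
  then have "ereal \<rho> \<le> conv_radius a"
    using conv_radius_geI[of a "of_real \<rho> :: complex"] \<rho> by simp
  then have "ereal 1 < conv_radius a"
    using \<rho>(1) by (meson ereal_less(3) less_ereal.simps(1) order_less_le_trans)
  then have "uniform_limit (cball 0 1) (\<lambda>d w. \<Sum>n<d. a n * (w - 0) ^ n)
      (\<lambda>w. \<Sum>n. a n * (w - 0) ^ n) sequentially"
    by (intro powser_uniform_limit) (simp add: one_ereal_def)
  also have "?this \<longleftrightarrow> uniform_limit (cball 0 1) S Q sequentially"
  proof (intro uniform_limit_cong' refl)
    fix w :: complex assume "w \<in> cball 0 1"
    then have "norm w < 1 / r" using \<rho> by simp
    then show "(\<Sum>n. a n * (w - 0) ^ n) = Q w"
      using sums by (simp add: sums_iff)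
  qed (simp add: S_def)
  finally have unif: "uniform_limit (cball 0 1) S Q sequentially" .
  have "(\<lambda>d. \<Lambda> (S d)) \<longlonglongrightarrow> \<Lambda> Q"
  proof (rule tendsto)
    show "\<forall>\<^sub>F d in sequentially. S d holomorphic_on unit_disc"
      unfolding S_def by (intro always_eventually allI holomorphic_intros)
    show "Q holomorphic_on unit_disc"
      using holomorphic_dilation[OF P r] by (simp add: Q_def[abs_def])
    show "uniform_limit (cball 0 s) S Q sequentially" if "s < 1" for s
      using unif by (rule uniform_limit_on_subset) (use that in auto)
  qed
  then have "(\<lambda>d. Re (\<Lambda> (S d))) \<longlonglongrightarrow> Re (\<Lambda> Q)" by (intro tendsto_intros)
  moreover have "\<forall>\<^sub>F d in sequentially. t - e \<le> Re (\<Lambda> (S d))"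
    using uniform_limitD[OF unif e]
  proof eventually_elim
    case (elim d)
    show ?case
      unfolding S_def
    proof (rule Re_polynomial_ge)
      fix u :: complex assume u: "u \<in> unit_circle"
      have "t \<le> Re (Q u)"
        unfolding Q_def using u \<rho> by (intro ge in_disc) simp
      moreover have "\<bar>Re (S d u - Q u)\<bar> < e"
        using bspec[OF elim, of u] u abs_Re_le_cmod[of "S d u - Q u"] by (simp add: dist_norm)
      ultimately show "t - e \<le> Re (\<Sum>n<d. a n * u ^ n)"
        by (simp add: S_def del: Re_sum)
    qed
  qed
  ultimately have "t - e \<le> Re (\<Lambda> Q)"
    by (intro tendsto_lowerbound[of _ _ sequentially]) auto
  then show "t \<le> Re (\<Lambda> (\<lambda>w. P (of_real r * w))) + e" by (simp add: Q_def[abs_def])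
qed

lemma Re_ge:
  assumes P: "P holomorphic_on unit_disc" and ge: "\<And>w. w \<in> unit_disc \<Longrightarrow> Re (P w) \<ge> t"
  shows "Re (\<Lambda> P) \<ge> t"
proof -
  have near_1: "\<forall>\<^sub>F r in at_left (1 :: real). 0 < r \<and> r < 1"
    using eventually_at_left_real[of 0 1] by simp
  have "((\<lambda>r. \<Lambda> (\<lambda>w. P (of_real r * w))) \<longlongrightarrow> \<Lambda> P) (at_left 1)"
  proof (rule tendsto)
    show "\<forall>\<^sub>F r in at_left 1. (\<lambda>w. P (of_real r * w)) holomorphic_on unit_disc"
      using near_1 by eventually_elim (use holomorphic_dilation[OF P] in auto)
    show "P holomorphic_on unit_disc" by fact
    fix s :: real assume s: "0 \<le> s" "s < 1"
    show "uniform_limit (cball 0 s) (\<lambda>r w. P (of_real r * w)) P (at_left 1)"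
    proof (rule uniform_limitI)
      fix e :: real assume e: "e > 0"
      have "uniformly_continuous_on (cball 0 s) P"
        using P s by (intro compact_uniformly_continuous holomorphic_on_imp_continuous_on)
          (auto intro: holomorphic_on_subset)
      then obtain \<delta> where \<delta>: "\<delta> > 0" "\<And>w w'. w \<in> cball 0 s \<Longrightarrow> w' \<in> cball 0 s \<Longrightarrow>
          dist w' w < \<delta> \<Longrightarrow> dist (P w') (P w) < e"
        using e unfolding uniformly_continuous_on_def by metis
      have "\<forall>\<^sub>F r in at_left (1 :: real). dist r 1 < \<delta>"
        using \<delta>(1) by (auto simp: eventually_at)
      with near_1 show "\<forall>\<^sub>F r in at_left 1. \<forall>w\<in>cball 0 s. dist (P (of_real r * w)) (P w) < e"
      proof eventually_elim
        case (elim r)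
        show ?case
        proof
          fix w :: complex assume w: "w \<in> cball 0 s"
          have "norm (of_real r * w) \<le> norm w"
            using elim by (simp add: norm_mult mult_left_le_one_le)
          moreover have "dist (of_real r * w) w < \<delta>"
          proof -
            have "of_real r * w - w = of_real (r - 1) * w" by (simp add: algebra_simps)
            then have "dist (of_real r * w) w = dist r 1 * norm w"
              by (simp only: dist_norm norm_mult norm_of_real real_norm_def)
            also have "\<dots> \<le> dist r 1 * 1"
              using w s by (intro mult_left_mono) auto
            finally show ?thesis using elim by simp
          qed
          ultimately show "dist (P (of_real r * w)) (P w) < e"
            using w by (intro \<delta>(2)) auto
        qed
      qed
    qed
  qed
  then have "((\<lambda>r. Re (\<Lambda> (\<lambda>w. P (of_real r * w)))) \<longlongrightarrow> Re (\<Lambda> P)) (at_left 1)"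
    by (intro tendsto_intros)
  moreover have "\<forall>\<^sub>F r in at_left 1. t \<le> Re (\<Lambda> (\<lambda>w. P (of_real r * w)))"
    using near_1 by eventually_elim (use Re_dilation_ge[OF P ge] in auto)
  ultimately show ?thesis
    by (intro tendsto_lowerbound[of _ _ "at_left (1 :: real)"]) auto
qed

text \<open>
  A closed convex set is an intersection of half-planes, and a rotation of the values brings each
  of them into the form treated by \<open>Re_ge\<close>.
\<close>

theorem in_closed_convex_hull:
  assumes P: "P holomorphic_on unit_disc"
  shows "\<Lambda> P \<in> closure (convex hull (P ` unit_disc))"
proof (rule ccontr)
  assume "\<Lambda> P \<notin> closure (convex hull (P ` unit_disc))"
  then obtain a b where ab: "inner a (\<Lambda> P) < b"
    "\<And>x. x \<in> closure (convex hull (P ` unit_disc)) \<Longrightarrow> inner a x > b"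
    using separating_hyperplane_closed_point[of "closure (convex hull (P ` unit_disc))" "\<Lambda> P"]
    by (auto simp: convex_closure)
  have inner: "inner a x = Re (cnj a * x)" for x by (simp add: inner_complex_def)
  have "Re (\<Lambda> (\<lambda>w. cnj a * P w)) \<ge> b"
  proof (rule Re_ge)
    show "(\<lambda>w. cnj a * P w) holomorphic_on unit_disc" using P by (intro holomorphic_intros)
    fix w assume "w \<in> unit_disc"
    then have "P w \<in> closure (convex hull (P ` unit_disc))"
      by (intro closure_subset[THEN subsetD] hull_inc) auto
    then show "Re (cnj a * P w) \<ge> b" using ab(2) inner by force
  qed
  then show False using ab(1) P by (simp add: scale inner del: times_complex.sel)
qed

end

section \<open>Values of a meromorphic quotient\<close>

text \<open>
  If the closed convex hull were not the plane, all values near the pole would lie in a half-plane,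
  which an affine change of the values turns into \<open>Re u > 0\<close>. Then \<open>1 / u\<close> also has positive real
  part, extends analytically by \<open>0\<close> to the pole, and is not constant, against the open mapping
  theorem.
\<close>

lemma pole_imp_finite_values_dense_hull:
  assumes D: "open D" and z: "z \<in> D" and q: "isolated_singularity_at q z" and pole: "is_pole q z"
  shows "closure (convex hull (finite_values q D)) = UNIV"
proof (rule ccontr)
  define C where "C = closure (convex hull (finite_values q D))"
  assume "closure (convex hull (finite_values q D)) \<noteq> UNIV"
  then obtain v where "v \<notin> C" by (auto simp: C_def)
  then obtain a b where ab: "inner a v < b" "\<And>x. x \<in> C \<Longrightarrow> inner a x > b"
    using separating_hyperplane_closed_point[of C v] by (auto simp: C_def convex_closure)
  obtain r1 where r1: "r1 > 0" "q analytic_on ball z r1 - {z}"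
    using q by (auto simp: isolated_singularity_at_def)
  obtain r2 where r2: "r2 > 0" "ball z r2 \<subseteq> D"
    using D z openE by blast
  define r where "r = min r1 r2"
  define B where "B = ball z r"
  have r: "r > 0" and B: "open B" "connected B" "z \<in> B" "B \<subseteq> D"
    using r1 r2 by (auto simp: r_def B_def)
  have q_B: "q analytic_on B - {z}"
    by (rule analytic_on_subset[OF r1(2)]) (auto simp: r_def B_def)
  have q_in_C: "q w \<in> C" if w: "w \<in> B - {z}" for w
  proof -
    have an: "q analytic_on {w}" by (rule analytic_on_subset[OF q_B]) (use w in auto)
    then have "\<not> is_pole q w"
      unfolding analytic_at using not_is_pole_holomorphic by blast
    then have "q w \<in> finite_values q D"
      using an w B(4) by (force simp: finite_values_def)
    then show ?thesis
      unfolding C_def by (intro closure_subset[THEN subsetD] hull_inc)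
  qed
  define w0 where "w0 = z + of_real (r / 2)"
  have w0: "w0 \<in> B - {z}" using r by (simp add: w0_def B_def dist_norm)
  have "a \<noteq> 0" using ab q_in_C[OF w0] by force
  define u where "u w = cnj a * q w + (- of_real b)" for w
  have Re_u: "Re (u w) > 0" if "w \<in> B - {z}" for w
    using ab(2)[OF q_in_C[OF that]] by (simp add: u_def inner_complex_def)
  define g where "g w = (if w = z then 0 else inverse (u w))" for w
  have "is_pole (\<lambda>w. cnj a * q w) z" using pole \<open>a \<noteq> 0\<close> by simp
  then have "is_pole u z"
    unfolding is_pole_def u_def by (rule tendsto_add_filterlim_at_infinity'[OF _ tendsto_const])
  moreover have "u holomorphic_on B - {z}"
    using analytic_imp_holomorphic[OF q_B] unfolding u_def by (intro holomorphic_intros)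
  ultimately have "g holomorphic_on B"
    unfolding g_def using Re_u by (intro is_pole_inverse_holomorphic B) fastforce+
  moreover have "\<not> g constant_on B"
  proof
    assume "g constant_on B"
    then have "g w0 = g z" using w0 B(3) by (auto simp: constant_on_def)
    then show False using w0 Re_u[OF w0] by (auto simp: g_def)
  qed
  ultimately have "open (g ` B)"
    using B by (intro open_mapping_thm[of g B B]) auto
  moreover have "0 \<in> g ` B" using B(3) by (force simp: g_def)
  ultimately obtain e where e: "e > 0" "ball 0 e \<subseteq> g ` B" using openE by blast
  have "- of_real (e / 2) \<in> ball (0 :: complex) e" using e(1) by simp
  with e(2) have "- of_real (e / 2) \<in> g ` B" by (rule subsetD)
  then obtain w where w: "w \<in> B" "g w = - of_real (e / 2)" by (metis imageE)
  then have "w \<noteq> z" using e(1) by (auto simp: g_def)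
  then have "u w = inverse (- of_real (e / 2))"
    using w(2) by (metis g_def inverse_inverse_eq)
  then have "u w = of_real (- (2 / e))" by (simp add: inverse_eq_divide)
  then have "Re (u w) = - (2 / e)" by (simp only: Re_complex_of_real)
  then show False using Re_u[of w] w(1) \<open>w \<noteq> z\<close> e(1) by simp
qed

lemma quotient_without_poles:
  assumes D: "open D" "connected D" and f: "f holomorphic_on D" and h: "h holomorphic_on D"
    and nz: "\<beta> \<in> D" "f \<beta> \<noteq> 0" and no_pole: "\<And>z. z \<in> D \<Longrightarrow> \<not> is_pole (\<lambda>z. h z / f z) z"
  obtains P where "P holomorphic_on D" "\<And>z. z \<in> D \<Longrightarrow> h z = f z * P z"
    "finite_values (\<lambda>z. h z / f z) D = P ` D"
proof -
  define q where "q z = h z / f z" for z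
  define P where "P = remove_sings q"
  have mero: "q meromorphic_on D"
    unfolding q_def using D f h
    by (intro meromorphic_on_divide analytic_on_imp_meromorphic_on) (simp_all add: analytic_on_open)
  have iso: "isolated_singularity_at q z" if "z \<in> D" for z
    using meromorphic_on_isolated_singularity[OF meromorphic_on_subset[OF mero]] that by blast
  have "P analytic_on D"
    unfolding P_def
    using no_pole iso
    by (intro nicely_meromorphic_without_singularities remove_sings_nicely_meromorphic mero)
      (simp_all flip: q_def)
  then have P: "P holomorphic_on D" by (rule analytic_imp_holomorphic)
  moreover have "h z = f z * P z" if z: "z \<in> D" for z
  proof -
    have cont: "isCont g z" if "g holomorphic_on D" for g
      using that z D(1) holomorphic_on_imp_continuous_on continuous_on_eq_continuous_at by blast
    have "\<forall>\<^sub>F w in at z. f w \<noteq> 0 \<and> w \<in> D"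
      using non_zero_neighbour_alt[OF f D z nz] .
    moreover have "\<forall>\<^sub>F w in at z. P w = q w"
      unfolding P_def using iso[OF z] by (rule eventually_remove_sings_eq_at)
    ultimately have "\<forall>\<^sub>F w in at z. f w * P w = h w"
      by eventually_elim (simp add: q_def)
    moreover have "((\<lambda>w. f w * P w) \<longlongrightarrow> f z * P z) (at z)"
      using cont[OF f] cont[OF P] unfolding isCont_def by (intro tendsto_intros)
    ultimately have "(h \<longlongrightarrow> f z * P z) (at z)"
      by (rule Lim_transform_eventually[rotated])
    then show ?thesis
      using cont[OF h] unfolding isCont_def by (metis LIM_unique)
  qed
  moreover have "finite_values q D = P ` D"
    using no_pole by (auto simp: finite_values_def P_def simp flip: q_def)
  ultimately show ?thesis using that unfolding q_def by blast
qed

section \<open>The half-plane condition for the kernels\<close>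

lemma continuous_nonzero_positive:
  fixes \<phi> :: "'a::topological_space \<Rightarrow> real"
  assumes "connected S" "continuous_on S \<phi>" and nz: "\<And>x. x \<in> S \<Longrightarrow> \<phi> x \<noteq> 0"
    and x0: "x0 \<in> S" "\<phi> x0 > 0" and x: "x \<in> S"
  shows "\<phi> x > 0"
proof (rule ccontr)
  assume "\<not> \<phi> x > 0"
  then have le: "\<phi> x \<le> 0" by simp
  have "connected (\<phi> ` S)" using assms by (intro connected_continuous_image)
  then have "0 \<in> \<phi> ` S"
    using connectedD_interval[of "\<phi> ` S" "\<phi> x" "\<phi> x0" 0] x x0 le by auto
  then show False using nz by auto
qed

lemma Re_divide_gt_half:
  fixes A S :: complex
  assumes "norm (S - A) < norm A" "S \<noteq> 0"
  shows "Re (A / S) > 1 / 2"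
proof -
  define u where "u = A / S"
  have "norm (1 - u) < norm u"
  proof -
    have "norm (1 - u) = norm (S - A) / norm S"
      using assms(2) by (simp add: u_def diff_divide_distrib flip: norm_divide)
    then show ?thesis using assms by (simp add: u_def norm_divide divide_strict_right_mono)
  qed
  then have "(norm (1 - u))\<^sup>2 < (norm u)\<^sup>2" by (intro power_strict_mono) auto
  then show ?thesis unfolding cmod_power2 by (simp add: u_def[symmetric] power2_eq_square algebra_simps)
qed

context disc_functional
begin

lemma disc_functional_divide: "disc_functional (\<lambda>g. \<Lambda> g / c)"
proof
  have "continuous_map hol_disc euclidean ((\<lambda>v. v / c) \<circ> \<Lambda>)"
    by (rule continuous_map_compose[OF continuous]) (simp add: divide_inverse continuous_intros)
  then show "continuous_map hol_disc euclidean (\<lambda>g. \<Lambda> g / c)" by (simp add: o_def)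
qed (simp add: linear add_divide_distrib)

lemma continuous_on_kernel: "continuous_on unit_circle (\<lambda>y. \<Lambda> (\<lambda>w. 1 / (1 - y * w)))"
  unfolding continuous_on_def
proof
  fix y :: complex assume y: "y \<in> unit_circle"
  show "((\<lambda>y. \<Lambda> (\<lambda>w. 1 / (1 - y * w))) \<longlongrightarrow> \<Lambda> (\<lambda>w. 1 / (1 - y * w))) (at y within unit_circle)"
  proof (rule tendsto)
    show "\<forall>\<^sub>F x in at y within unit_circle. (\<lambda>w. 1 / (1 - x * w)) holomorphic_on unit_disc"
      unfolding eventually_at_filter by (intro always_eventually) (auto intro: holomorphic_kernel)
    show "(\<lambda>w. 1 / (1 - y * w)) holomorphic_on unit_disc"
      using y by (intro holomorphic_kernel) simp
    fix s :: real assume s: "0 \<le> s" "s < 1"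
    have low: "1 - s \<le> norm (1 - x * w)" if "norm x = 1" "norm w \<le> s" for x w :: complex
      using norm_triangle_ineq2[of 1 "x * w"] that by (simp add: norm_mult)
    have bound: "dist (1 / (1 - x * w)) (1 / (1 - y * w)) \<le> dist x y / (1 - s)\<^sup>2"
      if x: "x \<in> unit_circle" and w: "w \<in> cball 0 s" for x w
    proof -
      have nx: "1 - s \<le> norm (1 - x * w)" and ny: "1 - s \<le> norm (1 - y * w)"
        using low x y w by auto
      then have ne: "1 - x * w \<noteq> 0" "1 - y * w \<noteq> 0" using s by auto
      have "1 / (1 - x * w) - 1 / (1 - y * w) = ((x - y) * w) / ((1 - x * w) * (1 - y * w))"
        using ne by (simp add: field_simps)
      then have "dist (1 / (1 - x * w)) (1 / (1 - y * w))
          = (dist x y * norm w) / (norm (1 - x * w) * norm (1 - y * w))"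
        by (simp only: dist_norm norm_divide norm_mult)
      also have "\<dots> \<le> (dist x y * 1) / ((1 - s) * (1 - s))"
        using nx ny s w by (intro frac_le mult_mono) auto
      finally show ?thesis by (simp add: power2_eq_square)
    qed
    show "uniform_limit (cball 0 s) (\<lambda>x w. 1 / (1 - x * w)) (\<lambda>w. 1 / (1 - y * w))
        (at y within unit_circle)"
    proof (rule uniform_limitI)
      fix e :: real assume e: "e > 0"
      have "((\<lambda>x. dist x y / (1 - s)\<^sup>2) \<longlongrightarrow> dist y y / (1 - s)\<^sup>2) (at y within unit_circle)"
        using s by (intro tendsto_intros) auto
      then have "\<forall>\<^sub>F x in at y within unit_circle. dist x y / (1 - s)\<^sup>2 < e"
        using e by (intro order_tendstoD) auto
      moreover have "\<forall>\<^sub>F x in at y within unit_circle. x \<in> unit_circle"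
        by (simp add: eventually_at_filter)
      ultimately show "\<forall>\<^sub>F x in at y within unit_circle. \<forall>w\<in>cball 0 s.
          dist (1 / (1 - x * w)) (1 / (1 - y * w)) < e"
        by eventually_elim (use bound in \<open>blast intro: order_le_less_trans\<close>)
    qed
  qed
qed

lemma kernel_split:
  assumes y: "y \<in> unit_circle"
  shows "\<Lambda> (\<lambda>w. 1 / (1 + y * w)) + x * \<Lambda> (\<lambda>w. w / (1 + y * w))
    = \<Lambda> (\<lambda>w. (1 + x * w) / (1 + y * w))"
proof -
  have ne: "1 + y * w \<noteq> 0" if "w \<in> unit_disc" for w
    using one_add_mult_neq_0 that y by simp
  have "\<Lambda> (\<lambda>w. 1 * (1 / (1 + y * w)) + x * (w / (1 + y * w)))
      = 1 * \<Lambda> (\<lambda>w. 1 / (1 + y * w)) + x * \<Lambda> (\<lambda>w. w / (1 + y * w))"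
    using ne by (intro linear holomorphic_intros) auto
  then show ?thesis by (simp add: add_divide_distrib)
qed

lemma one_eq_kernel_split:
  assumes y: "y \<in> unit_circle"
  shows "\<Lambda> (\<lambda>_. 1) = \<Lambda> (\<lambda>w. 1 / (1 + y * w)) + y * \<Lambda> (\<lambda>w. w / (1 + y * w))"
proof -
  have "\<Lambda> (\<lambda>_. 1) = \<Lambda> (\<lambda>w. (1 + y * w) / (1 + y * w))"
  proof (rule cong)
    fix w :: complex assume w: "w \<in> unit_disc"
    have "1 + y * w \<noteq> 0" using one_add_mult_neq_0 w y by simp
    then show "1 = (1 + y * w) / (1 + y * w)" by simp
  qed (intro holomorphic_intros)
  then show ?thesis using kernel_split[OF y, of y] by simp
qed

text \<open>
  Write \<open>A\<close>, \<open>B\<close> for the values at \<open>1 / (1 + y * w)\<close> and \<open>w / (1 + y * w)\<close>, so that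
  \<open>A + y * B = \<Lambda> (\<lambda>_. 1)\<close>. The quotient \<open>A / \<Lambda> (\<lambda>_. 1)\<close> lies on the line \<open>Re u = 1 / 2\<close> iff \<open>A\<close> and \<open>B\<close>
  have the same modulus, and in that case some \<open>x\<close> of modulus \<open>1\<close> solves \<open>A + x * B = 0\<close>.
\<close>

lemma Re_kernel_neq_half:
  assumes nz: "\<And>x. x \<in> unit_circle \<Longrightarrow> \<Lambda> (\<lambda>w. (1 + x * w) / (1 + y * w)) \<noteq> 0"
    and y: "y \<in> unit_circle"
  shows "Re (\<Lambda> (\<lambda>w. 1 / (1 + y * w)) / \<Lambda> (\<lambda>_. 1)) \<noteq> 1 / 2"
proof
  define A B S where "A = \<Lambda> (\<lambda>w. 1 / (1 + y * w))" and "B = \<Lambda> (\<lambda>w. w / (1 + y * w))"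
    and "S = \<Lambda> (\<lambda>_. 1)"
  define u where "u = A / S"
  assume "Re (\<Lambda> (\<lambda>w. 1 / (1 + y * w)) / \<Lambda> (\<lambda>_. 1)) = 1 / 2"
  then have half: "Re u = 1 / 2" by (simp add: u_def A_def S_def)
  have S: "S = A + y * B" unfolding S_def A_def B_def by (rule one_eq_kernel_split[OF y])
  have "S \<noteq> 0" using nz[OF y] kernel_split[OF y, of y] S by (simp add: A_def B_def)
  have "u \<noteq> 0" "1 - u \<noteq> 0" using half by (auto simp: complex_eq_iff)
  have "norm (1 - u) = norm u"
    using half by (simp add: cmod_def)
  \<comment> \<open>the solution of \<open>A + x * B = 0\<close>, as \<open>A = S * u\<close> and \<open>y * B = S * (1 - u)\<close>\<close>
  define x where "x = - y * u / (1 - u)"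
  have "x \<in> unit_circle"
    using \<open>norm (1 - u) = norm u\<close> \<open>u \<noteq> 0\<close> y by (simp add: x_def norm_divide norm_mult)
  have A: "A = S * u" using \<open>S \<noteq> 0\<close> by (simp add: u_def)
  then have yB: "y * B = S * (1 - u)" using S by (simp add: algebra_simps)
  have "x * B = - (u / (1 - u)) * (y * B)" by (simp add: x_def)
  also have "\<dots> = - S * u" unfolding yB using \<open>1 - u \<noteq> 0\<close> by simp
  finally have "A + x * B = 0" using A by simp
  then show False using nz[OF \<open>x \<in> unit_circle\<close>] kernel_split[OF y, of x]
    by (simp add: A_def B_def)
qed

end

lemma disc_functional_operator:
  assumes L: "continuous_linear_operator L" and f: "f holomorphic_on unit_disc"
    and z: "z \<in> unit_disc"
  shows "disc_functional (\<lambda>g. L (\<lambda>w. f w * g w) z)"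
proof
  have "continuous_map hol_disc euclidean ((\<lambda>k. k z) \<circ> L \<circ> (\<lambda>g w. f w * g w))"
    using L by (intro continuous_map_compose[OF continuous_map_hol_disc_mult[OF f]]
        continuous_map_compose[OF _ continuous_map_hol_disc_eval[OF z]])
      (simp add: continuous_linear_operator_def)
  then show "continuous_map hol_disc euclidean (\<lambda>g. L (\<lambda>w. f w * g w) z)" by (simp add: o_def)
next
  fix g1 g2 :: "complex \<Rightarrow> complex" and a b :: complex
  assume g: "g1 holomorphic_on unit_disc" "g2 holomorphic_on unit_disc"
  have "(\<lambda>w. f w * g1 w) holomorphic_on unit_disc" "(\<lambda>w. f w * g2 w) holomorphic_on unit_disc"
    using f g by (auto intro: holomorphic_intros)
  then have "L (\<lambda>w. a * (f w * g1 w) + b * (f w * g2 w)) z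
      = a * L (\<lambda>w. f w * g1 w) z + b * L (\<lambda>w. f w * g2 w) z"
    using L z unfolding continuous_linear_operator_def by blast
  then show "L (\<lambda>w. f w * (a * g1 w + b * g2 w)) z
      = a * L (\<lambda>w. f w * g1 w) z + b * L (\<lambda>w. f w * g2 w) z"
    by (simp add: algebra_simps)
qed

lemma holomorphic_operator:
  assumes "continuous_linear_operator L" "g holomorphic_on unit_disc"
  shows "L g holomorphic_on unit_disc"
  using assms by (auto simp: continuous_linear_operator_def continuous_map_def topspace_hol_disc)

text \<open>
  Let \<open>F y z\<close> be the value of the normalised functional at \<open>1 / (1 + y * w)\<close>. By
  \<open>Re_kernel_neq_half\<close> it never meets the line \<open>Re u = 1 / 2\<close>, and the modulus condition at \<open>y0\<close> puts
  \<open>F y0 0\<close> to the right of it. Moving first \<open>y\<close> along the circle with \<open>z = 0\<close>, then \<open>z\<close> through the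
  disc with \<open>y\<close> fixed, keeps \<open>F y z\<close> on that side, so only separate continuity is needed.
\<close>

lemma positive_disc_functional_operator:
  assumes L: "continuous_linear_operator L" and f: "f holomorphic_on unit_disc"
    and nz: "\<And>x y z. x \<in> unit_circle \<Longrightarrow> y \<in> unit_circle \<Longrightarrow> z \<in> unit_disc \<Longrightarrow>
      L (\<lambda>w. (1 + x * w) / (1 + y * w) * f w) z \<noteq> 0"
    and y0: "y0 \<in> unit_circle" "L (\<lambda>w. f w / (1 + y0 * w)) 0 \<noteq> 0"
      "cmod (L (\<lambda>w. w * f w / (1 + y0 * w)) 0 / L (\<lambda>w. f w / (1 + y0 * w)) 0) < 1"
    and z: "z \<in> unit_disc"
  shows "L f z \<noteq> 0" "positive_disc_functional (\<lambda>g. L (\<lambda>w. f w * g w) z / L f z)"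
proof -
  define M where "M z g = L (\<lambda>w. f w * g w) z" for z g
  have M: "disc_functional (M z)" if "z \<in> unit_disc" for z
    unfolding M_def using L f that by (rule disc_functional_operator)
  have nzM: "M z (\<lambda>w. (1 + x * w) / (1 + y * w)) \<noteq> 0"
    if "x \<in> unit_circle" "y \<in> unit_circle" "z \<in> unit_disc" for x y z
    using nz[OF that] by (simp add: M_def mult.commute)
  have one: "M z (\<lambda>_. 1) = L f z" for z by (simp add: M_def)
  have Lf: "L f z \<noteq> 0" if z: "z \<in> unit_disc" for z
  proof -
    interpret disc_functional "M z" using M[OF z] .
    show ?thesis
      using nzM[of 1 1 z] z one_eq_kernel_split[of 1] kernel_split[of 1 1] by (simp add: one)
  qed
  define F where "F y z = M z (\<lambda>w. 1 / (1 + y * w)) / L f z" for y z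
  have F_neq: "Re (F y z) - 1 / 2 \<noteq> 0" if "y \<in> unit_circle" "z \<in> unit_disc" for y z
  proof -
    interpret disc_functional "M z" using M that(2) .
    show ?thesis
      using Re_kernel_neq_half[OF nzM[OF _ that] that(1)] by (simp add: F_def one)
  qed
  have start: "Re (F y0 0) - 1 / 2 > 0"
  proof -
    interpret disc_functional "M 0" using M by simp
    define A where "A = M 0 (\<lambda>w. 1 / (1 + y0 * w))"
    define B where "B = M 0 (\<lambda>w. w / (1 + y0 * w))"
    have AL: "A = L (\<lambda>w. f w / (1 + y0 * w)) 0" and BL: "B = L (\<lambda>w. w * f w / (1 + y0 * w)) 0"
      by (simp_all add: A_def B_def M_def mult.commute)
    have "norm B < norm A" using y0(2,3) by (simp add: norm_divide flip: AL BL)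
    moreover have "L f 0 - A = y0 * B"
      using one_eq_kernel_split[OF y0(1)] by (simp add: one A_def B_def)
    ultimately have "norm (L f 0 - A) < norm A" using y0(1) by (simp add: norm_mult)
    then show ?thesis using Re_divide_gt_half[OF _ Lf[of 0]] by (simp add: F_def A_def)
  qed
  have F_gt: "Re (F y z) - 1 / 2 > 0" if y: "y \<in> unit_circle" for y
  proof (rule continuous_nonzero_positive[of unit_disc "\<lambda>z. Re (F y z) - 1 / 2" 0 z])
    have ne: "1 + y * w \<noteq> 0" if "w \<in> unit_disc" for w
      using one_add_mult_neq_0 that y by simp
    have "L (\<lambda>w. f w * (1 / (1 + y * w))) holomorphic_on unit_disc"
      using f ne by (intro holomorphic_operator[OF L] holomorphic_intros) auto
    then show "continuous_on unit_disc (\<lambda>z. Re (F y z) - 1 / 2)"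
      unfolding F_def M_def using holomorphic_operator[OF L f] Lf
      by (intro continuous_intros holomorphic_on_imp_continuous_on) auto
    show "Re (F y 0) - 1 / 2 > 0"
    proof (rule continuous_nonzero_positive[of unit_circle "\<lambda>y. Re (F y 0) - 1 / 2" y0 y])
      interpret disc_functional "M 0" using M by simp
      have "continuous_on unit_circle (\<lambda>y. M 0 (\<lambda>w. 1 / (1 - (- y) * w)))"
        by (rule continuous_on_compose2[OF continuous_on_kernel]) (auto intro: continuous_intros)
      then show "continuous_on unit_circle (\<lambda>y. Re (F y 0) - 1 / 2)"
        unfolding F_def using Lf[of 0] by (intro continuous_intros) auto
      show "connected unit_circle" by (rule connected_sphere) simp
    qed (use y y0 start F_neq in auto)
  qed (use y z F_neq in auto)
  show "L f z \<noteq> 0" using Lf[OF z] .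
  interpret disc_functional "M z" using M[OF z] .
  interpret \<Lambda>: disc_functional "\<lambda>g. M z g / L f z" by (rule disc_functional_divide)
  have "positive_disc_functional (\<lambda>g. M z g / L f z)"
  proof
    show "M z (\<lambda>_. 1) / L f z = 1" using Lf[OF z] by (simp add: one)
    fix y :: complex assume "y \<in> unit_circle"
    then have "- y \<in> unit_circle" by simp
    from F_gt[OF this] show "1 / 2 \<le> Re (M z (\<lambda>w. 1 / (1 - y * w)) / L f z)"
      by (simp add: F_def)
  qed
  then show "positive_disc_functional (\<lambda>g. L (\<lambda>w. f w * g w) z / L f z)" by (simp add: M_def)
qed

section \<open>The convex hull theorem\<close>

theorem lemma8:
  fixes L :: "(complex \<Rightarrow> complex) \<Rightarrow> (complex \<Rightarrow> complex)"
    and f :: "complex \<Rightarrow> complex"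
  assumes "continuous_linear_operator L"
    and "f holomorphic_on unit_disc"
    and "\<And>x y z. x \<in> unit_circle \<Longrightarrow> y \<in> unit_circle \<Longrightarrow> z \<in> unit_disc \<Longrightarrow>
           L (\<lambda>w. (1 + x * w) / (1 + y * w) * f w) z \<noteq> 0"
    and "\<exists>y\<in>unit_circle.
           L (\<lambda>w. f w / (1 + y * w)) 0 \<noteq> 0 \<and>
           cmod (L (\<lambda>w. w * f w / (1 + y * w)) 0 / L (\<lambda>w. f w / (1 + y * w)) 0) < 1"
  shows "\<forall>h. h holomorphic_on unit_disc \<longrightarrow>
           finite_values (\<lambda>z. L h z / L f z) unit_disc
             \<subseteq> closure (convex hull (finite_values (\<lambda>z. h z / f z) unit_disc))"
proof (intro allI impI subsetI)
  fix h v
  assume h: "h holomorphic_on unit_disc"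
    and v: "v \<in> finite_values (\<lambda>z. L h z / L f z) unit_disc"
  note L = assms(1) and f = assms(2)
  obtain y0 where y0: "y0 \<in> unit_circle" "L (\<lambda>w. f w / (1 + y0 * w)) 0 \<noteq> 0"
    "cmod (L (\<lambda>w. w * f w / (1 + y0 * w)) 0 / L (\<lambda>w. f w / (1 + y0 * w)) 0) < 1"
    using assms(4) by blast
  have Lf: "L f z \<noteq> 0"
    and pos: "positive_disc_functional (\<lambda>g. L (\<lambda>w. f w * g w) z / L f z)"
    if "z \<in> unit_disc" for z
    by (rule positive_disc_functional_operator[OF L f _ y0 that], use assms(3) in auto)+
  obtain z where z: "z \<in> unit_disc" and v_eq: "v = remove_sings (\<lambda>z. L h z / L f z) z"
    using v by (auto simp: finite_values_def)
  have "(\<lambda>z. L h z / L f z) holomorphic_on unit_disc"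
    using holomorphic_operator[OF L] f h Lf by (intro holomorphic_intros) auto
  then have "(\<lambda>z. L h z / L f z) analytic_on {z}"
    using z unfolding analytic_at by (intro exI[of _ unit_disc]) simp
  then have v_val: "v = L h z / L f z" unfolding v_eq by (rule remove_sings_at_analytic)
  show "v \<in> closure (convex hull (finite_values (\<lambda>z. h z / f z) unit_disc))"
  proof (cases "\<exists>p\<in>unit_disc. is_pole (\<lambda>z. h z / f z) p")
    case True
    then obtain p where p: "p \<in> unit_disc" "is_pole (\<lambda>z. h z / f z) p" by blast
    have "(\<lambda>z. h z / f z) meromorphic_on {p}"
      using f h p(1)
      by (intro meromorphic_on_divide analytic_on_imp_meromorphic_on)
        (auto simp: analytic_at intro!: exI[of _ unit_disc])
    then have "isolated_singularity_at (\<lambda>z. h z / f z) p" by (simp add: meromorphic_at_iff)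
    then show ?thesis
      using pole_imp_finite_values_dense_hull[OF open_ball p(1) _ p(2)] by simp
  next
    case False
    interpret at_z: disc_functional "\<lambda>g. L g z"
      using disc_functional_operator[OF L holomorphic_on_const z, of 1] by simp
    have "\<exists>\<beta>\<in>unit_disc. f \<beta> \<noteq> 0"
    proof (rule ccontr)
      assume "\<not> (\<exists>\<beta>\<in>unit_disc. f \<beta> \<noteq> 0)"
      then have "f w = 0" if "w \<in> unit_disc" for w using that by blast
      then have "L f z = L (\<lambda>_. 0) z" by (rule at_z.cong[OF f])
      also have "\<dots> = 0" using at_z.scale[OF holomorphic_on_const, of 0] by simp
      finally show False using Lf[OF z] by simp
    qed
    then obtain \<beta> where \<beta>: "\<beta> \<in> unit_disc" "f \<beta> \<noteq> 0" by blast
    obtain P where P: "P holomorphic_on unit_disc" "\<And>z. z \<in> unit_disc \<Longrightarrow> h z = f z * P z"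
      "finite_values (\<lambda>z. h z / f z) unit_disc = P ` unit_disc"
      using quotient_without_poles[OF open_ball connected_ball f h \<beta>] False by blast
    have "L h z = L (\<lambda>w. f w * P w) z"
      using h P(2) by (rule at_z.cong)
    then have "v = L (\<lambda>w. f w * P w) z / L f z" by (simp add: v_val)
    also have "\<dots> \<in> closure (convex hull (P ` unit_disc))"
      by (rule positive_disc_functional.in_closed_convex_hull[OF pos[OF z] P(1)])
    finally show ?thesis using P(3) by simp
  qed
qed

end
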